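(* Let $n\ge 1$ and put $m_n:=\left\lfloor\frac{n+1}{2}\right\rfloor$. For normal matrices $A,B\in M_n(\mathbb{C})$, \[ d(\sigma(A),\sigma(B))\le \sqrt{\min\{\operatorname{rank}(A-B),\,m_n\}}\;\lVert A-B\rVert . \] In particular, if $A-B$ has rank at most one, then \[ d(\sigma(A),\sigma(B))\le\lVert A-B\rVert . \]
   Context: For normal $A,B\in M_n(\mathbb{C})$ write $\sigma(A)=\{\alpha_1,\ldots,\alpha_n\}$ and $\sigma(B)=\{\beta_1,\ldots,\beta_n\}$ for the spectra, with eigenvalues counted with algebraic multiplicity. The optimal matching distance is \[ d(\sigma(A),\sigma(B))=\min_{\tau\in S_n}\max_{1\le i\le n}|\alpha_i-\beta_{\tau(i)}| , \] where $S_n$ is the group of permutations of $\{1,\ldots,n\}$. The norm $\lVert\cdot\rVert$ is the spectral (operator) norm. *)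

theory Defs
  imports
    "HOL-Computational_Algebra.Fundamental_Theorem_Algebra"
    "HOL-Combinatorics.List_Permutation"
    "Jordan_Normal_Form.Char_Poly"
    "Jordan_Normal_Form.Schur_Decomposition"
    "Jordan_Normal_Form.DL_Rank"
begin

definition normal_mat :: "complex mat \<Rightarrow> bool" where
  "normal_mat A \<longleftrightarrow> square_mat A \<and> A * mat_adjoint A = mat_adjoint A * A"

definition vec_norm2 :: "complex vec \<Rightarrow> real" where
  "vec_norm2 v = sqrt (\<Sum>i<dim_vec v. (cmod (v $ i))\<^sup>2)"

definition spectral_norm :: "complex mat \<Rightarrow> real" where
  "spectral_norm A = Sup {vec_norm2 (A *\<^sub>v x) | x. x \<in> carrier_vec (dim_col A) \<and> vec_norm2 x \<le> 1}"

text \<open>The multiplicity of an element is its order as a root of the characteristic polynomial.\<close>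

definition eigenvalue_mset :: "complex mat \<Rightarrow> complex multiset" where
  "eigenvalue_mset A = proots (char_poly A)"

lemma size_eigenvalue_mset: "A \<in> carrier_mat n n \<Longrightarrow> size (eigenvalue_mset A) = n"
  unfolding eigenvalue_mset_def using degree_monic_char_poly[of A n]
  by (simp add: size_proots_complex)

definition matching_dist_list :: "complex list \<Rightarrow> complex list \<Rightarrow> real" where
  "matching_dist_list xs ys =
     Min ((\<lambda>\<tau>. Max ((\<lambda>i. cmod (xs ! i - ys ! \<tau> i)) ` {..<length xs}))
            ` {\<tau>. \<tau> permutes {..<length xs}})"

text \<open>
  Only meant for multisets of the same size. The enumerations are chosen arbitrarily; by
  \<open>matching_dist_mset\<close> below, the value does not depend on them.
\<close>

definition matching_dist :: "complex multiset \<Rightarrow> complex multiset \<Rightarrow> real" where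
  "matching_dist M N = matching_dist_list (SOME xs. mset xs = M) (SOME ys. mset ys = N)"

lemma matching_dist_list_permute:
  assumes p: "p permutes {..<length xs}" and q: "q permutes {..<length ys}"
    and len: "length xs = length ys"
  shows "matching_dist_list (permute_list p xs) (permute_list q ys) = matching_dist_list xs ys"
proof -
  define n where "n = length xs"
  define g where "g \<tau> = Max ((\<lambda>i. cmod (xs ! i - ys ! \<tau> i)) ` {..<n})" for \<tau>
  define h where "h \<tau> = Max ((\<lambda>i. cmod (permute_list p xs ! i - permute_list q ys ! \<tau> i)) ` {..<n})" for \<tau>
  have pn: "p permutes {..<n}" and qn: "q permutes {..<n}"
    using p q len by (auto simp: n_def)
  have h_eq: "h \<tau> = g (q \<circ> \<tau> \<circ> inv_into UNIV p)" if t: "\<tau> permutes {..<n}" for \<tau>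
  proof -
    have "(\<lambda>i. cmod (permute_list p xs ! i - permute_list q ys ! \<tau> i)) ` {..<n}
        = (\<lambda>i. cmod (xs ! p i - ys ! q (\<tau> i))) ` {..<n}"
    proof (rule image_cong[OF refl])
      fix i assume i: "i \<in> {..<n}"
      then have "\<tau> i < n" using permutes_in_image[OF t] by auto
      then show "cmod (permute_list p xs ! i - permute_list q ys ! \<tau> i)
          = cmod (xs ! p i - ys ! q (\<tau> i))"
        using i p q len by (simp add: permute_list_nth n_def)
    qed
    also have "\<dots> = (\<lambda>i. cmod (xs ! i - ys ! (q \<circ> \<tau> \<circ> inv_into UNIV p) i)) ` (p ` {..<n})"
      unfolding image_image using permutes_inverses(2)[OF pn] by simp
    also have "p ` {..<n} = {..<n}" using permutes_image[OF pn] .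
    finally show ?thesis by (simp add: h_def g_def)
  qed
  have "h ` {\<tau>. \<tau> permutes {..<n}} = g ` {\<tau>. \<tau> permutes {..<n}}"
  proof (intro equalityI subsetI)
    fix z assume "z \<in> h ` {\<tau>. \<tau> permutes {..<n}}"
    then obtain \<tau> where t: "\<tau> permutes {..<n}" "z = h \<tau>" by auto
    have "(q \<circ> \<tau> \<circ> inv_into UNIV p) permutes {..<n}"
      by (intro permutes_compose permutes_inv pn qn t(1))
    then show "z \<in> g ` {\<tau>. \<tau> permutes {..<n}}" using h_eq[OF t(1)] t(2) by blast
  next
    fix z assume "z \<in> g ` {\<tau>. \<tau> permutes {..<n}}"
    then obtain \<tau> where t: "\<tau> permutes {..<n}" "z = g \<tau>" by auto
    have r: "(inv_into UNIV q \<circ> \<tau> \<circ> p) permutes {..<n}"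
      by (intro permutes_compose permutes_inv pn qn t(1))
    have "q \<circ> (inv_into UNIV q \<circ> \<tau> \<circ> p) \<circ> inv_into UNIV p = \<tau>"
      using permutes_inverses[OF pn] permutes_inverses[OF qn] by (auto simp: fun_eq_iff)
    then have "z = h (inv_into UNIV q \<circ> \<tau> \<circ> p)" using h_eq[OF r] t(2) by simp
    then show "z \<in> h ` {\<tau>. \<tau> permutes {..<n}}" using r by blast
  qed
  then show ?thesis
    unfolding matching_dist_list_def g_def h_def by (simp add: n_def)
qed

lemma matching_dist_mset:
  assumes len: "length xs = length ys"
  shows "matching_dist (mset xs) (mset ys) = matching_dist_list xs ys"
proof -
  define xs' where "xs' = (SOME zs. mset zs = mset xs)"
  define ys' where "ys' = (SOME zs. mset zs = mset ys)"
  have "mset xs' = mset xs" unfolding xs'_def by (rule someI[of _ xs]) simp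
  then obtain p where p: "p permutes {..<length xs}" "permute_list p xs = xs'"
    by (rule mset_eq_permutation)
  have "mset ys' = mset ys" unfolding ys'_def by (rule someI[of _ ys]) simp
  then obtain q where q: "q permutes {..<length ys}" "permute_list q ys = ys'"
    by (rule mset_eq_permutation)
  show ?thesis
    using matching_dist_list_permute[OF p(1) q(1) len] p(2) q(2)
    by (simp add: matching_dist_def xs'_def ys'_def)
qed

end

theory Submission
  imports Defs "HOL-Analysis.L2_Norm"
begin

text \<open>
  If the matching distance exceeds \<open>\<delta>\<close>, Hall's theorem gives sets \<open>S\<close>, \<open>T\<close> of eigenvalues of \<open>A\<close> and
  \<open>B\<close> with \<open>|S| + |T| = n + 1\<close> that are more than \<open>\<delta>\<close> apart. In unitary eigenbases \<open>U\<close>, \<open>V\<close> of \<open>A\<close>, \<open>B\<close>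
  put \<open>W = U\<^sup>*V\<close> and \<open>C = U\<^sup>*(A - B)V\<close>; then \<open>C\<^sub>i\<^sub>j = (\<alpha>\<^sub>i - \<beta>\<^sub>j) W\<^sub>i\<^sub>j\<close>. Since \<open>W\<close> is unitary, its block
  on \<open>S \<times> T\<close> has squared Frobenius norm at least \<open>|S| + |T| - n = 1\<close>, so that of \<open>C\<close> has at least \<open>\<delta>\<^sup>2\<close>.
  On the other hand, the latter is at most \<open>min {rank (A - B), |S|, |T|}\<close> times \<open>\<parallel>A - B\<parallel>\<^sup>2\<close>, and
  \<open>min {|S|, |T|} \<le> (n + 1) div 2\<close>.
\<close>

section \<open>Norms and adjoints\<close>

lemma mat_adjoint_dim [simp]:
  "dim_row (mat_adjoint A) = dim_col A" "dim_col (mat_adjoint A) = dim_row A"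
  by (simp_all add: mat_adjoint_def)

lemma mat_adjoint_carrier [simp, intro]:
  "A \<in> carrier_mat m n \<Longrightarrow> mat_adjoint A \<in> carrier_mat n m"
  by (intro carrier_matI) auto

lemma mat_adjoint_index [simp]:
  fixes A :: "complex mat"
  assumes "i < dim_col A" "j < dim_row A"
  shows "mat_adjoint A $$ (i, j) = cnj (A $$ (j, i))"
  using assms by (simp add: mat_adjoint_def mat_of_rows_def)

lemma mat_adjoint_adjoint [simp]:
  fixes A :: "complex mat"
  shows "mat_adjoint (mat_adjoint A) = A"
  by (rule eq_matI) auto

lemma mat_adjoint_mult:
  fixes A B :: "complex mat"
  assumes "A \<in> carrier_mat m k" "B \<in> carrier_mat k n"
  shows "mat_adjoint (A * B) = mat_adjoint B * mat_adjoint A"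
  using assms by (intro eq_matI) (auto simp: scalar_prod_def mult.commute)

lemma mult_adjoint_vec_scalar:
  fixes A :: "complex mat"
  assumes "A \<in> carrier_mat m n" "x \<in> carrier_vec n" "y \<in> carrier_vec m"
  shows "(A *\<^sub>v x) \<bullet>c y = x \<bullet>c (mat_adjoint A *\<^sub>v y)"
proof -
  have "(A *\<^sub>v x) \<bullet>c y = (\<Sum>i<m. \<Sum>j<n. A $$ (i,j) * x $ j * cnj (y $ i))"
    using assms by (simp add: scalar_prod_def sum_distrib_right lessThan_atLeast0)
  also have "\<dots> = (\<Sum>j<n. \<Sum>i<m. A $$ (i,j) * x $ j * cnj (y $ i))"
    by (rule sum.swap)
  also have "\<dots> = x \<bullet>c (mat_adjoint A *\<^sub>v y)"
    using assms
    by (simp add: scalar_prod_def sum_distrib_left lessThan_atLeast0 mult_ac)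
  finally show ?thesis .
qed

section \<open>The Euclidean norm of complex vectors\<close>

lemma vec_norm2_L2_set: "vec_norm2 v = L2_set (\<lambda>i. cmod (v $ i)) {..<dim_vec v}"
  by (simp add: vec_norm2_def L2_set_def)

lemma vec_norm2_nonneg [simp]: "0 \<le> vec_norm2 v"
  by (simp add: vec_norm2_def sum_nonneg)

lemma vec_norm2_square: "(vec_norm2 v)\<^sup>2 = (\<Sum>i<dim_vec v. (cmod (v $ i))\<^sup>2)"
  by (simp add: vec_norm2_def sum_nonneg)

lemma vec_norm2_scalar: "v \<bullet>c v = complex_of_real ((vec_norm2 v)\<^sup>2)"
  by (simp add: vec_norm2_square scalar_prod_def complex_norm_square lessThan_atLeast0 del: of_real_power)

lemma vec_norm2_smult: "vec_norm2 (c \<cdot>\<^sub>v v) = cmod c * vec_norm2 v"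
  by (simp add: vec_norm2_def norm_mult power_mult_distrib real_sqrt_mult flip: sum_distrib_left)

lemma vec_norm2_eq_0_iff: "vec_norm2 v = 0 \<longleftrightarrow> v = 0\<^sub>v (dim_vec v)"
  by (auto simp: vec_norm2_L2_set L2_set_eq_0_iff vec_eq_iff)

lemma vec_norm2_unit: "i < n \<Longrightarrow> vec_norm2 (unit_vec n i) = 1"
  by (simp add: vec_norm2_def unit_vec_def if_distrib[of cmod] if_distrib[of "\<lambda>x. x\<^sup>2"] cong: if_cong)

text \<open>Cauchy-Schwarz: the triangle inequality reduces it to the real inequality
  \<open>L2_set_mult_ineq\<close> for the moduli of the entries.\<close>

lemma cmod_scalar_prod_le:
  assumes "dim_vec x = dim_vec y"
  shows "cmod (x \<bullet>c y) \<le> vec_norm2 x * vec_norm2 y"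
proof -
  have "cmod (x \<bullet>c y) \<le> (\<Sum>i<dim_vec y. cmod (x $ i) * cmod (y $ i))"
    by (auto simp: scalar_prod_def lessThan_atLeast0 norm_mult intro!: sum_norm_le)
  also have "\<dots> \<le> vec_norm2 x * vec_norm2 y"
    using L2_set_mult_ineq[of "\<lambda>i. cmod (x $ i)" "\<lambda>i. cmod (y $ i)" "{..<dim_vec y}"] assms
    by (simp add: vec_norm2_L2_set)
  finally show ?thesis .
qed

text \<open>Moving \<open>E\<close> across the inner product turns
  \<open>\<langle>E x, E x\<rangle>\<close> into \<open>\<langle>x, E\<^sup>* E x\<rangle>\<close>.
  Rectangular \<open>E\<close> is allowed because orthonormal bases of proper subspaces occur in the
  rank bound.\<close>

lemma isometry_vec_norm2:
  fixes E :: "complex mat"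
  assumes E: "E \<in> carrier_mat n r" "mat_adjoint E * E = 1\<^sub>m r" and x: "x \<in> carrier_vec r"
  shows "vec_norm2 (E *\<^sub>v x) = vec_norm2 x"
proof -
  have "complex_of_real ((vec_norm2 (E *\<^sub>v x))\<^sup>2) = x \<bullet>c (mat_adjoint E *\<^sub>v (E *\<^sub>v x))"
    unfolding vec_norm2_scalar[symmetric] using E x by (intro mult_adjoint_vec_scalar) auto
  also have "mat_adjoint E *\<^sub>v (E *\<^sub>v x) = x"
    using E x by (simp flip: assoc_mult_mat_vec[of _ r n _ r])
  finally show ?thesis
    by (simp only: vec_norm2_scalar of_real_eq_iff) (simp add: power2_eq_iff_nonneg)
qed

text \<open>\<open>\<parallel>A\<^sup>* y\<parallel>\<^sup>2 = \<langle>A A\<^sup>* y, y\<rangle> \<le> K \<parallel>A\<^sup>* y\<parallel> \<parallel>y\<parallel>\<close>.\<close>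

lemma adjoint_vec_norm2_le:
  fixes A :: "complex mat"
  assumes A: "A \<in> carrier_mat m n" and K: "0 \<le> K"
    and bound: "\<And>x. x \<in> carrier_vec n \<Longrightarrow> vec_norm2 (A *\<^sub>v x) \<le> K * vec_norm2 x"
    and y: "y \<in> carrier_vec m"
  shows "vec_norm2 (mat_adjoint A *\<^sub>v y) \<le> K * vec_norm2 y"
proof -
  let ?z = "mat_adjoint A *\<^sub>v y"
  have z: "?z \<in> carrier_vec n"
    using A y by (intro mult_mat_vec_carrier[OF mat_adjoint_carrier])
  have "complex_of_real ((vec_norm2 ?z)\<^sup>2) = (A *\<^sub>v ?z) \<bullet>c y"
    using mult_adjoint_vec_scalar[OF A z y] by (simp add: vec_norm2_scalar)
  then have "(vec_norm2 ?z)\<^sup>2 = cmod ((A *\<^sub>v ?z) \<bullet>c y)"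
    by (metis norm_of_real abs_of_nonneg zero_le_power2)
  also have "\<dots> \<le> vec_norm2 (A *\<^sub>v ?z) * vec_norm2 y"
    using A y by (intro cmod_scalar_prod_le) auto
  also have "\<dots> \<le> (K * vec_norm2 ?z) * vec_norm2 y"
    using bound[OF z] by (intro mult_right_mono) auto
  finally have "vec_norm2 ?z * vec_norm2 ?z \<le> (K * vec_norm2 y) * vec_norm2 ?z"
    by (simp add: power2_eq_square mult_ac)
  then show ?thesis
    using K by (cases "vec_norm2 ?z = 0") (auto simp: less_le)
qed

text \<open>A real \<open>Sup\<close> can be estimated from below by members only if the set is
  bounded above. Cauchy-Schwarz applied to each row gives such a bound, and scaling to unit length
  then extends the estimate to all vectors.\<close>

lemma spectral_norm:
  fixes M :: "complex mat"
  assumes M: "M \<in> carrier_mat m n"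
  shows spectral_norm_nonneg: "0 \<le> spectral_norm M"
    and vec_norm2_mult_le: "x \<in> carrier_vec n \<Longrightarrow> vec_norm2 (M *\<^sub>v x) \<le> spectral_norm M * vec_norm2 x"
proof -
  define X where "X = {vec_norm2 (M *\<^sub>v x) | x. x \<in> carrier_vec n \<and> vec_norm2 x \<le> 1}"
  define R where "R = (\<Sum>i<m. vec_norm2 (conjugate (row M i)))"
  have sn: "spectral_norm M = Sup X"
    using M by (simp add: spectral_norm_def X_def)
  have le_sum: "vec_norm2 v \<le> (\<Sum>i<dim_vec v. cmod (v $ i))" for v
    unfolding vec_norm2_L2_set by (rule L2_set_le_sum) simp
  have "y \<le> R" if yX: "y \<in> X" for y
  proof -
    obtain x where x: "x \<in> carrier_vec n" "vec_norm2 x \<le> 1" and y: "y = vec_norm2 (M *\<^sub>v x)"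
      using yX unfolding X_def by blast
    have "cmod ((M *\<^sub>v x) $ i) \<le> vec_norm2 (conjugate (row M i))" if i: "i < m" for i
    proof -
      have "cmod ((M *\<^sub>v x) $ i) = cmod (x \<bullet>c conjugate (row M i))"
        using M x i comm_scalar_prod[of "row M i" n x] by auto
      also have "\<dots> \<le> vec_norm2 x * vec_norm2 (conjugate (row M i))"
        using M x by (intro cmod_scalar_prod_le) auto
      also have "\<dots> \<le> 1 * vec_norm2 (conjugate (row M i))"
        using x by (intro mult_right_mono) auto
      finally show ?thesis by simp
    qed
    then show ?thesis
      unfolding y R_def using M by (intro order_trans[OF le_sum]) (auto intro!: sum_mono)
  qed
  then have bdd: "bdd_above X" by (rule bdd_aboveI)
  \<comment> \<open>Any member of \<open>X\<close> is a norm, hence nonnegative, and lies below the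
    supremum; the zero vector supplies one in every dimension, including 0.\<close>
  have "vec_norm2 (M *\<^sub>v 0\<^sub>v n) \<in> X"
    unfolding X_def by (auto intro!: exI[of _ "0\<^sub>v n"] simp: vec_norm2_def)
  from cSup_upper[OF this bdd] show nonneg: "0 \<le> spectral_norm M"
    unfolding sn by (rule order_trans[rotated]) simp
  show "vec_norm2 (M *\<^sub>v x) \<le> spectral_norm M * vec_norm2 x" if x: "x \<in> carrier_vec n"
  proof (cases "vec_norm2 x = 0")
    case True
    then have "x = 0\<^sub>v n" using x by (simp add: vec_norm2_eq_0_iff)
    then have "M *\<^sub>v x = 0\<^sub>v m" using M by auto
    then show ?thesis using True by (simp add: vec_norm2_def)
  next
    case False
    then have pos: "vec_norm2 x > 0" by (simp add: less_le)
    let ?y = "complex_of_real (inverse (vec_norm2 x)) \<cdot>\<^sub>v x"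
    have "vec_norm2 (M *\<^sub>v ?y) \<in> X"
      unfolding X_def using x pos by (auto intro!: exI[of _ ?y] simp: vec_norm2_smult norm_inverse)
    from cSup_upper[OF this bdd] have "vec_norm2 (M *\<^sub>v ?y) \<le> spectral_norm M"
      unfolding sn .
    moreover have "M *\<^sub>v ?y = complex_of_real (inverse (vec_norm2 x)) \<cdot>\<^sub>v (M *\<^sub>v x)"
      using M x by (intro mult_mat_vec) auto
    ultimately show ?thesis
      using pos by (simp add: vec_norm2_smult norm_inverse norm_divide field_simps)
  qed
qed

section \<open>Columns and the Frobenius norm\<close>

lemma mult_mat_unit_vec:
  fixes M :: "'a :: semiring_1 mat"
  assumes "M \<in> carrier_mat m n" "j < n"
  shows "M *\<^sub>v unit_vec n j = col M j"
  using assms by (intro eq_vecI) auto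

lemma col_vec_norm2_le:
  assumes M: "M \<in> carrier_mat m n"
    and bound: "\<And>x. x \<in> carrier_vec n \<Longrightarrow> vec_norm2 (M *\<^sub>v x) \<le> K * vec_norm2 x"
    and j: "j < n"
  shows "vec_norm2 (col M j) \<le> K"
  using bound[of "unit_vec n j"] j by (simp add: mult_mat_unit_vec[OF M] vec_norm2_unit)

text \<open>The square of the Frobenius norm. It is summed by columns because a left factor acts on
  each column separately, so that isometries visibly preserve it.\<close>

definition frob2 :: "complex mat \<Rightarrow> real" where
  "frob2 M = (\<Sum>j<dim_col M. (vec_norm2 (col M j))\<^sup>2)"

lemma frob2_altdef: "frob2 M = (\<Sum>j<dim_col M. \<Sum>i<dim_row M. (cmod (M $$ (i,j)))\<^sup>2)"
  by (simp add: frob2_def vec_norm2_square)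

lemma frob2_adjoint [simp]: "frob2 (mat_adjoint M) = frob2 M"
  by (simp add: frob2_altdef) (rule sum.swap)

lemma frob2_isometry:
  assumes E: "E \<in> carrier_mat n r" "mat_adjoint E * E = 1\<^sub>m r" and M: "M \<in> carrier_mat r k"
  shows "frob2 (E * M) = frob2 M"
  using assms by (simp add: frob2_def col_mult2 isometry_vec_norm2[OF E] del: col_mult)

lemma frob2_le:
  assumes M: "M \<in> carrier_mat m n"
    and bound: "\<And>x. x \<in> carrier_vec n \<Longrightarrow> vec_norm2 (M *\<^sub>v x) \<le> K * vec_norm2 x"
  shows "frob2 M \<le> real n * K\<^sup>2"
proof -
  have "(\<Sum>j<n. (vec_norm2 (col M j))\<^sup>2) \<le> (\<Sum>j<n. K\<^sup>2)"
    by (intro sum_mono power_mono col_vec_norm2_le[OF M bound]) auto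
  then show ?thesis using M by (simp add: frob2_def)
qed

section \<open>Orthonormal bases and rank\<close>

text \<open>Identifies \<open>E\<^sup>* E\<close> as the Gram matrix of the columns of
  \<open>E\<close>, so that \<open>E\<^sup>* E = 1\<close> expresses their orthonormality.\<close>

lemma adjoint_mult_index:
  fixes A B :: "complex mat"
  assumes "A \<in> carrier_mat n k" "B \<in> carrier_mat n l" "i < k" "j < l"
  shows "(mat_adjoint A * B) $$ (i, j) = col B j \<bullet>c col A i"
  using assms by (auto simp: scalar_prod_def intro!: sum.cong)

context
  fixes n :: nat
begin

interpretation cof_vec_space n "TYPE(complex)" .

text \<open>Gram-Schmidt followed by normalization. The statement about the span serves the rank
  bound \<open>frob2_le_rank\<close>; the one about column 0 keeps a prescribed first vector, up to
  a scalar, in \<open>unitary_with_eigenvector\<close>.\<close>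

lemma orthonormalize:
  assumes ws: "set ws \<subseteq> carrier_vec n" "distinct ws" "lin_indpt (set ws)"
  obtains E where "E \<in> carrier_mat n (length ws)" "mat_adjoint E * E = 1\<^sub>m (length ws)"
    "\<And>y. y \<in> span (set ws) \<Longrightarrow> \<exists>x\<in>carrier_vec (length ws). y = E *\<^sub>v x"
    "ws \<noteq> [] \<Longrightarrow> \<exists>c. col E 0 = c \<cdot>\<^sub>v hd ws"
proof -
  define us where "us = gram_schmidt n ws"
  define r where "r = length ws"
  note gs = gram_schmidt_result[OF ws us_def]
  have us_car: "us ! j \<in> carrier_vec n" if "j < r" for j
    using gs(3,4) that by (auto simp: r_def)
  have pos: "vec_norm2 (us ! j) \<noteq> 0" if "j < r" for j
    using corthogonalD[OF gs(2), of j j] that gs(4) by (auto simp: vec_norm2_scalar r_def)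
  define s where "s j = complex_of_real (vec_norm2 (us ! j))" for j
  have s: "s j \<noteq> 0" "cnj (s j) = s j" "us ! j \<bullet>c us ! j = s j * s j" if "j < r" for j
    using pos[OF that] by (simp_all add: s_def vec_norm2_scalar power2_eq_square)
  define E where "E = mat n r (\<lambda>(i, j). us ! j $ i / s j)"
  have E: "E \<in> carrier_mat n r" by (simp add: E_def)
  have col: "col E j = inverse (s j) \<cdot>\<^sub>v us ! j" if "j < r" for j
    using that us_car[OF that] by (intro eq_vecI) (auto simp: E_def divide_inverse)
  have "mat_adjoint E * E = 1\<^sub>m r"
  proof (rule eq_matI)
    fix i j assume "i < dim_row (1\<^sub>m r :: complex mat)" "j < dim_col (1\<^sub>m r :: complex mat)"
    then have ij: "i < r" "j < r" by auto
    have "(mat_adjoint E * E) $$ (i, j) = inverse (s j) * (cnj (inverse (s i)) * (us ! j \<bullet>c us ! i))"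
      using us_car[OF ij(1)] us_car[OF ij(2)]
      by (simp add: adjoint_mult_index[OF E E ij] col ij conjugate_smult_vec)
    then show "(mat_adjoint E * E) $$ (i, j) = 1\<^sub>m r $$ (i, j)"
      using ij s corthogonalD[OF gs(2), of j i] gs(4) by (auto simp: r_def field_simps)
  qed (use E in auto)
  moreover have "\<exists>x\<in>carrier_vec r. y = E *\<^sub>v x" if "y \<in> span (set ws)" for y
  proof -
    have "y \<in> span_list us"
      using that gs(1) span_list_as_span[OF gs(3)] by simp
    then obtain c where "y = lincomb_list c us" by (auto simp: span_list_def)
    also have "\<dots> = mat_of_cols n us *\<^sub>v vec r c"
      using gs(3,4) by (subst lincomb_list_as_mat_mult) (auto simp: r_def)
    \<comment> \<open>Column \<open>j\<close> of \<open>E\<close> is \<open>us ! j\<close> divided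
      by \<open>s j\<close>, which the coefficients have to compensate.\<close>
    also have "\<dots> = E *\<^sub>v vec r (\<lambda>j. s j * c j)"
      using s(1) gs(4)
      by (intro eq_vecI) (auto simp: E_def mat_of_cols_def scalar_prod_def r_def intro!: sum.cong)
    finally show ?thesis by (rule bexI) simp
  qed
  moreover have "\<exists>c. col E 0 = c \<cdot>\<^sub>v hd ws" if ne: "ws \<noteq> []"
  proof -
    obtain v vs where w: "ws = v # vs" using ne by (cases ws) auto
    have "hd us = v" using ws(1) by (simp add: us_def w)
    moreover have "us \<noteq> []" using gs(4) w by auto
    ultimately have "us ! 0 = hd ws" using hd_conv_nth[of us] by (simp add: w)
    then show ?thesis using col[of 0] by (auto simp: r_def w)
  qed
  ultimately show ?thesis using that E by (simp add: r_def)
qed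

text \<open>An eigenvector is completed to a basis and orthonormalized with the eigenvector in first
  position, where Gram-Schmidt changes it only by a scalar.\<close>

lemma unitary_with_eigenvector:
  fixes A :: "complex mat"
  assumes A: "A \<in> carrier_mat n n" and "n > 0"
  obtains E e where "E \<in> carrier_mat n n" "mat_adjoint E * E = 1\<^sub>m n"
    "A *\<^sub>v col E 0 = e \<cdot>\<^sub>v col E 0"
proof -
  \<comment> \<open>The characteristic polynomial splits into \<open>n\<close> linear factors; as
    \<open>n > 0\<close>, there is at least one root.\<close>
  obtain as where as: "char_poly A = (\<Prod>a\<leftarrow>as. [:- a, 1:])" "length as = n"
    using char_poly_factorized[OF A] by blast
  then obtain e where "e \<in> set as" using \<open>n > 0\<close> by (cases as) auto
  then have "poly (char_poly A) e = 0"
    unfolding as by (auto simp: poly_prod_list prod_list_zero_iff)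
  then obtain v where v: "v \<in> carrier_vec n" "v \<noteq> 0\<^sub>v n" "A *\<^sub>v v = e \<cdot>\<^sub>v v"
    using eigenvalue_root_char_poly[OF A] A by (auto simp: eigenvalue_def eigenvector_def)
  note bc = basis_completion[OF v(1,2)]
  obtain E where E: "E \<in> carrier_mat n n" "mat_adjoint E * E = 1\<^sub>m n"
    "\<exists>c. col E 0 = c \<cdot>\<^sub>v hd (basis_completion v)"
    using orthonormalize[OF bc(2,4,5)] bc(6) \<open>n > 0\<close>
    by (metis less_irrefl list.size(3))
  then obtain c where c: "col E 0 = c \<cdot>\<^sub>v v" using bc(7) by auto
  have "A *\<^sub>v col E 0 = e \<cdot>\<^sub>v col E 0"
    unfolding c using A v by (simp add: mult_mat_vec smult_smult_assoc mult.commute)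
  with E show ?thesis by (intro that)
qed

text \<open>Let the \<open>r = rank D\<close> columns of \<open>E\<close> be an orthonormal basis of
  the column space of \<open>D\<close>. Then \<open>D = E E\<^sup>* D\<close>, so \<open>D\<close>
  has the Frobenius norm of \<open>E\<^sup>* D\<close>, which is that of \<open>D\<^sup>* E\<close>.
  The latter has only \<open>r\<close> columns, each of norm at most \<open>K\<close>.\<close>

lemma frob2_le_rank:
  fixes D :: "complex mat"
  assumes D: "D \<in> carrier_mat n k" and K: "0 \<le> K"
    and bound: "\<And>x. x \<in> carrier_vec k \<Longrightarrow> vec_norm2 (D *\<^sub>v x) \<le> K * vec_norm2 x"
  shows "frob2 D \<le> real (rank D) * K\<^sup>2"
proof -
  have cols: "set (cols D) \<subseteq> carrier_vec n" using D cols_dim by blast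
  obtain S where S: "finite S" "maximal S (\<lambda>T. T \<subseteq> set (cols D) \<and> lin_indpt T)"
    using maximal_exists_superset[of "set (cols D)" "\<lambda>T. T \<subseteq> set (cols D) \<and> lin_indpt T" "{}"]
    by (auto simp: lin_dep_def)
  have S': "S \<subseteq> set (cols D)" "lin_indpt S" using S(2) by (auto simp: maximal_def)
  have span: "c \<in> span S" if c: "c \<in> set (cols D)" for c
  proof (rule ccontr)
    assume nin: "c \<notin> span S"
    have "c \<notin> S" using nin S' cols span_mem[of S c] by auto
    then have "lin_indpt (S \<union> {c})"
      using lin_dep_iff_in_span[of S c] S' cols c nin by auto
    then show False
      using S(2) c S' \<open>c \<notin> S\<close> unfolding maximal_def by blast
  qed
  obtain ws where ws: "set ws = S" "distinct ws" using finite_distinct_list[OF S(1)] by blast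
  have "set ws \<subseteq> carrier_vec n" "lin_indpt (set ws)" using ws S' cols by auto
  from orthonormalize[OF this(1) ws(2) this(2)]
  obtain E where E: "E \<in> carrier_mat n (length ws)" "mat_adjoint E * E = 1\<^sub>m (length ws)"
    "\<And>y. y \<in> span (set ws) \<Longrightarrow> \<exists>x\<in>carrier_vec (length ws). y = E *\<^sub>v x"
    by metis
  let ?r = "length ws"
  have E': "mat_adjoint E \<in> carrier_mat ?r n" and D': "mat_adjoint D \<in> carrier_mat k n"
    using E(1) D by auto
  have r: "rank D = ?r"
    using rank_card_indpt[OF D S(2)] ws distinct_card by metis
  \<comment> \<open>\<open>E E\<^sup>*\<close> is the orthogonal projection onto the column space of
    \<open>D\<close> and thus fixes every column of \<open>D\<close>.\<close>
  have D_eq: "D = E * (mat_adjoint E * D)"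
  proof (rule mat_col_eqI)
    fix j assume "j < dim_col (E * (mat_adjoint E * D))"
    then have j: "j < k" using D by simp
    obtain x where x: "x \<in> carrier_vec ?r" "col D j = E *\<^sub>v x"
      using E(3)[of "col D j"] span[of "col D j"] ws D j by (auto simp: cols_def)
    have "col (E * (mat_adjoint E * D)) j = E *\<^sub>v (mat_adjoint E *\<^sub>v col D j)"
      using D E(1) E' j by (simp add: col_mult2[OF E(1) mult_carrier_mat[OF E' D]] col_mult2[OF E' D] del: col_mult)
    also have "mat_adjoint E *\<^sub>v col D j = x"
      unfolding x(2) using E(1,2) E' x(1) by (simp flip: assoc_mult_mat_vec[of _ ?r n _ ?r])
    finally show "col D j = col (E * (mat_adjoint E * D)) j" using x(2) by simp
  qed (use D E(1) in auto)
  have "frob2 D = frob2 (mat_adjoint E * D)"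
    by (subst D_eq) (rule frob2_isometry[OF E(1,2) mult_carrier_mat[OF E' D]])
  \<comment> \<open>Passing to the adjoint replaces \<open>k\<close> columns by
    \<open>rank D\<close> columns, which makes the columnwise estimate \<open>frob2_le\<close> sharp
    enough.\<close>
  also have "\<dots> = frob2 (mat_adjoint D * E)"
    using mat_adjoint_mult[OF E' D] by (metis frob2_adjoint mat_adjoint_adjoint)
  also have "\<dots> \<le> real ?r * K\<^sup>2"
  proof (rule frob2_le[OF mult_carrier_mat[OF D' E(1)]])
    fix x :: "complex vec" assume x: "x \<in> carrier_vec ?r"
    then have "vec_norm2 (mat_adjoint D * E *\<^sub>v x) = vec_norm2 (mat_adjoint D *\<^sub>v (E *\<^sub>v x))"
      using E(1) D' by (simp add: assoc_mult_mat_vec[of _ k n _ ?r])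
    also have "\<dots> \<le> K * vec_norm2 (E *\<^sub>v x)"
      using E(1) x by (intro adjoint_vec_norm2_le[OF D K bound]) auto
    finally show "vec_norm2 (mat_adjoint D * E *\<^sub>v x) \<le> K * vec_norm2 x"
      using isometry_vec_norm2[OF E(1,2) x] by simp
  qed
  finally show ?thesis by (simp add: r)
qed

end

section \<open>Diagonalization of normal matrices\<close>

lemma normal_matD:
  assumes "normal_mat A" "A \<in> carrier_mat n n"
  shows "A * mat_adjoint A = mat_adjoint A * A"
  using assms by (simp add: normal_mat_def)

lemma normal_mat_unitary_conj:
  assumes A: "A \<in> carrier_mat n n" "normal_mat A"
    and E: "E \<in> carrier_mat n n" "E * mat_adjoint E = 1\<^sub>m n"
  shows "normal_mat (mat_adjoint E * A * E)"
proof -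
  have E': "mat_adjoint E \<in> carrier_mat n n" and A': "mat_adjoint A \<in> carrier_mat n n"
    using A E by auto
  note assoc = assoc_mult_mat[of _ n n _ n _ n] mult_carrier_mat[of _ n n _ n]
  \<comment> \<open>With all products nested to the right, a factor and its inverse meet only in
    front of a further factor \<open>X\<close>; the rewrite rules have this form for that
    reason.\<close>
  have cancel: "E * (mat_adjoint E * X) = X" if "X \<in> carrier_mat n n" for X
    using E E' that by (simp flip: assoc_mult_mat[of _ n n _ n _ n])
  have swap: "A * (mat_adjoint A * X) = mat_adjoint A * (A * X)" if "X \<in> carrier_mat n n" for X
    using A A' normal_matD[OF A(2,1)] that by (simp flip: assoc_mult_mat[of _ n n _ n _ n])
  have adj: "mat_adjoint (mat_adjoint E * A * E) = mat_adjoint E * mat_adjoint A * E"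
    using A(1) A' E(1) E'
    by (simp add: assoc mat_adjoint_mult[of _ n n _ n])
  show ?thesis
    unfolding normal_mat_def adj using A(1) A' E(1) E'
    by (simp add: assoc cancel swap)
qed

text \<open>Comparing the \<open>(0, 0)\<close> entries of \<open>A A\<^sup>*\<close> and \<open>A\<^sup>* A\<close>.\<close>

lemma normal_mat_row_0:
  assumes A: "A \<in> carrier_mat n n" "normal_mat A"
    and col: "\<And>i. 0 < i \<Longrightarrow> i < n \<Longrightarrow> A $$ (i, 0) = 0"
    and j: "0 < j" "j < n"
  shows "A $$ (0, j) = 0"
proof -
  have n: "0 < n" using j by simp
  have "complex_of_real (\<Sum>k\<in>{..<n}. (cmod (A $$ (0, k)))\<^sup>2) = (A * mat_adjoint A) $$ (0, 0)"
    using A n by (simp add: scalar_prod_def complex_norm_square lessThan_atLeast0 del: of_real_power)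
  also have "\<dots> = complex_of_real (\<Sum>k\<in>{..<n}. (cmod (A $$ (k, 0)))\<^sup>2)"
    using A n by (simp add: normal_matD scalar_prod_def complex_norm_square lessThan_atLeast0 mult.commute del: of_real_power)
  also have "(\<Sum>k\<in>{..<n}. (cmod (A $$ (k, 0)))\<^sup>2) = (cmod (A $$ (0, 0)))\<^sup>2"
    using n col by (subst sum.remove[of _ 0]) auto
  also have "(\<Sum>k\<in>{..<n}. (cmod (A $$ (0, k)))\<^sup>2)
      = (cmod (A $$ (0, 0)))\<^sup>2 + (\<Sum>k\<in>{..<n} - {0}. (cmod (A $$ (0, k)))\<^sup>2)"
    using n by (subst sum.remove[of _ 0]) auto
  finally have "(\<Sum>k\<in>{..<n} - {0}. (cmod (A $$ (0, k)))\<^sup>2) = 0"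
    unfolding of_real_eq_iff by simp
  then show ?thesis
    using j by (subst (asm) sum_nonneg_eq_0_iff) auto
qed

text \<open>Induction on the dimension by deflation: in an orthonormal basis starting with an
  eigenvector, column 0 vanishes below the diagonal, normality makes row 0 vanish as well, and the
  remaining block is normal and smaller.\<close>

theorem normal_mat_diagonalization:
  assumes "A \<in> carrier_mat n n" "normal_mat A"
  shows "\<exists>U. U \<in> carrier_mat n n \<and> mat_adjoint U * U = 1\<^sub>m n \<and> diagonal_mat (mat_adjoint U * A * U)"
  using assms
proof (induction n arbitrary: A)
  case 0
  then show ?case
    by (intro exI[of _ "1\<^sub>m 0"]) (auto simp: diagonal_mat_def)
next
  case (Suc m)
  let ?n = "Suc m"
  note A = Suc.prems
  note assoc = assoc_mult_mat[of _ ?n ?n _ ?n _ ?n] mult_carrier_mat[of _ ?n ?n _ ?n]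
  obtain E e where E: "E \<in> carrier_mat ?n ?n" "mat_adjoint E * E = 1\<^sub>m ?n"
    and ev: "A *\<^sub>v col E 0 = e \<cdot>\<^sub>v col E 0"
    using unitary_with_eigenvector[OF A(1)] by blast
  have E': "mat_adjoint E \<in> carrier_mat ?n ?n" using E by auto
  have EE': "E * mat_adjoint E = 1\<^sub>m ?n"
    using mat_mult_left_right_inverse[OF E' E(1) E(2)] .
  define A1 where "A1 = mat_adjoint E * A * E"
  have A1: "A1 \<in> carrier_mat ?n ?n" "normal_mat A1"
    using A E E' normal_mat_unitary_conj[OF A E(1) EE'] by (auto simp: A1_def)
  have col0: "A1 $$ (i, 0) = e * 1\<^sub>m ?n $$ (i, 0)" if i: "i < ?n" for i
  proof -
    have "A1 $$ (i, 0) = (mat_adjoint E * (A * E)) $$ (i, 0)"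
      unfolding A1_def using A E E' by (simp add: assoc)
    also have "\<dots> = col (A * E) 0 \<bullet>c col E i"
      using A E i by (intro adjoint_mult_index[of _ ?n]) auto
    also have "col (A * E) 0 = e \<cdot>\<^sub>v col E 0"
      using col_mult2[OF A(1) E(1), of 0] ev by simp
    also have "(e \<cdot>\<^sub>v col E 0) \<bullet>c col E i = e * (col E 0 \<bullet>c col E i)"
      using E by simp
    also have "col E 0 \<bullet>c col E i = (mat_adjoint E * E) $$ (i, 0)"
      using E i by (intro adjoint_mult_index[symmetric, of _ ?n]) auto
    finally show ?thesis unfolding E(2) .
  qed
  have col_zero: "A1 $$ (i, 0) = 0" if "0 < i" "i < ?n" for i
    using col0[OF that(2)] that by simp
  have row_zero: "A1 $$ (0, j) = 0" if "0 < j" "j < ?n" for j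
    using normal_mat_row_0[OF A1 col_zero that] by blast
  define A3 where "A3 = mat m m (\<lambda>(i, j). A1 $$ (Suc i, Suc j))"
  have A3: "A3 \<in> carrier_mat m m" by (simp add: A3_def)
  \<comment> \<open>The products for \<open>A1\<close> have one more summand, at index 0. It
    vanishes in \<open>A1 * mat_adjoint A1\<close> by \<open>col_zero\<close> and in
    \<open>mat_adjoint A1 * A1\<close> by \<open>row_zero\<close>.\<close>
  have "normal_mat A3"
    unfolding normal_mat_def
  proof
    show "A3 * mat_adjoint A3 = mat_adjoint A3 * A3"
    proof (rule eq_matI)
      fix i j assume "i < dim_row (mat_adjoint A3 * A3)" "j < dim_col (mat_adjoint A3 * A3)"
      then have ij: "i < m" "j < m" using A3 by auto
      have "(A3 * mat_adjoint A3) $$ (i, j) = (A1 * mat_adjoint A1) $$ (Suc i, Suc j)"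
        using ij A1 A3 col_zero
        by (simp add: scalar_prod_def A3_def sum.atLeast0_lessThan_Suc_shift del: sum.op_ivl_Suc)
      also have "\<dots> = (mat_adjoint A1 * A1) $$ (Suc i, Suc j)"
        using normal_matD[OF A1(2,1)] by simp
      also have "\<dots> = (mat_adjoint A3 * A3) $$ (i, j)"
        using ij A1 A3 row_zero
        by (simp add: scalar_prod_def A3_def sum.atLeast0_lessThan_Suc_shift del: sum.op_ivl_Suc)
      finally show "(A3 * mat_adjoint A3) $$ (i, j) = (mat_adjoint A3 * A3) $$ (i, j)" .
    qed (use A3 in auto)
  qed (use A3 in auto)
  from Suc.IH[OF A3 this] obtain U where U: "U \<in> carrier_mat m m" "mat_adjoint U * U = 1\<^sub>m m"
    "diagonal_mat (mat_adjoint U * A3 * U)" by blast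
  have U': "mat_adjoint U \<in> carrier_mat m m" using U by auto
  let ?B = "\<lambda>X Y. four_block_mat X (0\<^sub>m 1 m) (0\<^sub>m m 1) Y"
  \<comment> \<open>The unitary \<open>U\<close> diagonalizing the small block is extended by 1 so
    as to keep the eigenvector; \<open>E * F\<close> then diagonalizes \<open>A\<close>.\<close>
  define F where "F = ?B (1\<^sub>m 1) U"
  define c where "c = mat 1 1 (\<lambda>_. e)"
  have F: "F \<in> carrier_mat ?n ?n"
    using four_block_carrier_mat[of "1\<^sub>m 1" 1 1 U m m "0\<^sub>m 1 m" "0\<^sub>m m 1"] U by (simp add: F_def)
  then have F': "mat_adjoint F \<in> carrier_mat ?n ?n" by auto
  have F'_eq: "mat_adjoint F = ?B (1\<^sub>m 1) (mat_adjoint U)"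
    using U F by (intro eq_matI) (auto simp: F_def)
  have A1_eq: "A1 = ?B c A3"
    using A1 A3 col0[of 0] col_zero row_zero by (intro eq_matI) (auto simp: c_def A3_def)
  have block_mult: "?B X Y * ?B X' Y' = ?B (X * X') (Y * Y')"
    if "X \<in> carrier_mat 1 1" "X' \<in> carrier_mat 1 1" "Y \<in> carrier_mat m m" "Y' \<in> carrier_mat m m"
    for X X' Y Y' :: "complex mat"
    using that by (subst mult_four_block_mat[of _ 1 1 _ m _ m _ _ 1 _ m]) auto
  have c: "c \<in> carrier_mat 1 1" by (simp add: c_def)
  have block_diag: "diagonal_mat (?B X Y)"
    if "X \<in> carrier_mat 1 1" "Y \<in> carrier_mat m m" "diagonal_mat Y" for X Y :: "complex mat"
    using that by (auto simp: diagonal_mat_def)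
  have FF: "mat_adjoint F * F = 1\<^sub>m ?n"
    unfolding F'_eq unfolding F_def using U U' by (simp add: block_mult del: One_nat_def) simp
  have FAF: "mat_adjoint F * A1 * F = ?B c (mat_adjoint U * A3 * U)"
    unfolding F'_eq A1_eq unfolding F_def using U U' A3 c
    by (simp add: block_mult mult_carrier_mat[OF U' A3] del: One_nat_def)
  have adj: "mat_adjoint (E * F) = mat_adjoint F * mat_adjoint E"
    by (rule mat_adjoint_mult[OF E(1) F])
  show ?case
  proof (intro exI[of _ "E * F"] conjI)
    show "E * F \<in> carrier_mat ?n ?n" using E F by auto
    have "mat_adjoint E * (E * F) = F"
      using E E' F by (simp flip: assoc_mult_mat[of _ ?n ?n _ ?n _ ?n])
    then show "mat_adjoint (E * F) * (E * F) = 1\<^sub>m ?n"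
      unfolding adj using E E' F F' FF by (simp add: assoc)
    have "mat_adjoint (E * F) * A * (E * F) = mat_adjoint F * A1 * F"
      unfolding adj A1_def using A E E' F F' by (simp add: assoc)
    also have "diagonal_mat \<dots>"
      unfolding FAF by (rule block_diag[OF c _ U(3)]) (use U U' A3 in auto)
    finally show "diagonal_mat (mat_adjoint (E * F) * A * (E * F))" .
  qed
qed

section \<open>Eigenvalues as diagonal entries\<close>

lemma proots_prod_linear_factors:
  fixes as :: "'a :: idom list"
  shows "proots (\<Prod>a\<leftarrow>as. [:- a, 1:]) = mset as"
proof (induction as)
  case (Cons a as)
  have "(\<Prod>a\<leftarrow>as. [:- a, 1:]) \<noteq> 0" by (auto simp: prod_list_zero_iff)
  then show ?case using Cons by (simp add: proots_mult del: mult_pCons_left)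
qed simp

text \<open>Similar matrices share their characteristic polynomial, and a diagonal matrix shows its
  factors. The diagonal thereby becomes an enumeration of the eigenvalues to which
  \<open>matching_dist_mset\<close> applies.\<close>

lemma eigenvalue_mset_unitary_conj:
  assumes A: "A \<in> carrier_mat n n" and U: "U \<in> carrier_mat n n" "mat_adjoint U * U = 1\<^sub>m n"
    and diag: "diagonal_mat (mat_adjoint U * A * U)"
  shows "eigenvalue_mset A = mset (diag_mat (mat_adjoint U * A * U))"
proof -
  let ?D = "mat_adjoint U * A * U"
  have U': "mat_adjoint U \<in> carrier_mat n n" using U by auto
  have D: "?D \<in> carrier_mat n n" using A U U' by auto
  have "U * mat_adjoint U = 1\<^sub>m n"
    using mat_mult_left_right_inverse[OF U' U(1) U(2)] .
  then have "similar_mat ?D A"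
    using A U U' D by (intro similar_matI[of _ _ _ _ n]) auto
  then have "char_poly A = char_poly ?D" by (simp add: char_poly_similar)
  also have "\<dots> = (\<Prod>a\<leftarrow>diag_mat ?D. [:- a, 1:])"
    using diag D by (intro char_poly_upper_triangular[OF D]) (auto simp: diagonal_mat_def)
  finally show ?thesis
    by (simp add: eigenvalue_mset_def proots_prod_linear_factors)
qed

section \<open>Bottlenecks of matchings\<close>

text \<open>The induction of Halmos and Vaughan. If every nonempty proper subset has a surplus of
  neighbours, one element may be matched at will, since this costs the others at most one neighbour.
  Otherwise a tight proper subset and its complement are matched separately.\<close>

theorem hall_marriage:
  assumes "finite I" and "\<And>i. i \<in> I \<Longrightarrow> finite (N i)"
    and "\<And>S. S \<subseteq> I \<Longrightarrow> card S \<le> card (\<Union>(N ` S))"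
  shows "\<exists>f. inj_on f I \<and> (\<forall>i\<in>I. f i \<in> N i)"
  using assms
proof (induction I arbitrary: N rule: finite_psubset_induct)
  case (psubset I)
  note fin = psubset.prems(1) and hall = psubset.prems(2)
  consider "I = {}"
    | (slack) "I \<noteq> {}" "\<And>S. S \<subset> I \<Longrightarrow> S \<noteq> {} \<Longrightarrow> card S < card (\<Union>(N ` S))"
    | (tight) S where "S \<subset> I" "S \<noteq> {}" "card (\<Union>(N ` S)) \<le> card S"
    by (meson not_less)
  then show ?case
  proof cases
    case 1
    then show ?thesis by simp
  next
    case slack
    then obtain i where i: "i \<in> I" by auto
    have "N i \<noteq> {}" using hall[of "{i}"] i by auto
    then obtain x where x: "x \<in> N i" by auto
    have "\<exists>f. inj_on f (I - {i}) \<and> (\<forall>j\<in>I - {i}. f j \<in> N j - {x})"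
    proof (rule psubset.IH)
      fix S assume S: "S \<subseteq> I - {i}"
      have eq: "(\<Union>j\<in>S. N j - {x}) = \<Union>(N ` S) - {x}" by auto
      show "card S \<le> card (\<Union>j\<in>S. N j - {x})"
      proof (cases "S = {}")
        case False
        then have "card S < card (\<Union>(N ` S))" using S i by (intro slack(2)) auto
        then show ?thesis unfolding eq using x by (auto simp: card_Diff_singleton_if)
      qed simp
    qed (use i fin in auto)
    then obtain f where "inj_on f (I - {i})" "\<forall>j\<in>I - {i}. f j \<in> N j - {x}" by blast
    then have "inj_on (f(i := x)) I \<and> (\<forall>j\<in>I. (f(i := x)) j \<in> N j)"
      using x by (auto simp: inj_on_def)
    then show ?thesis by blast
  next
    case tight
    define B where "B = \<Union>(N ` S)"
    have finI: "finite T" if "T \<subseteq> I" for T using that psubset.hyps by (rule finite_subset)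
    have "\<exists>f. inj_on f S \<and> (\<forall>i\<in>S. f i \<in> N i)"
      using tight fin hall by (intro psubset.IH) auto
    then obtain f where f: "inj_on f S" "\<forall>i\<in>S. f i \<in> N i" by blast
    have "\<exists>g. inj_on g (I - S) \<and> (\<forall>i\<in>I - S. g i \<in> N i - B)"
    proof (rule psubset.IH)
      fix T assume T: "T \<subseteq> I - S"
      \<comment> \<open>Hall's condition for \<open>T\<close> after removing \<open>B\<close> comes
        from that for \<open>T \<union> S\<close>: the set \<open>B\<close> accounts for at most
        \<open>card S\<close> neighbours.\<close>
      have "card T + card S = card (T \<union> S)"
        using T tight by (intro card_Un_disjoint[symmetric] finI) auto
      also have "\<dots> \<le> card (\<Union>(N ` (T \<union> S)))"
        using T tight by (intro hall) auto
      also have "\<Union>(N ` (T \<union> S)) = (\<Union>i\<in>T. N i - B) \<union> B" by (auto simp: B_def)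
      also have "card \<dots> \<le> card (\<Union>i\<in>T. N i - B) + card B" by (rule card_Un_le)
      finally show "card T \<le> card (\<Union>i\<in>T. N i - B)"
        using tight(3) unfolding B_def by linarith
    qed (use tight fin in auto)
    then obtain g where g: "inj_on g (I - S)" "\<forall>i\<in>I - S. g i \<in> N i - B"
      by blast
    let ?h = "\<lambda>i. if i \<in> S then f i else g i"
    have "f ` S \<inter> g ` (I - S) = {}"
    proof -
      have "f ` S \<subseteq> B" using f(2) by (auto simp: B_def)
      moreover have "g ` (I - S) \<subseteq> - B" using g(2) by auto
      ultimately show ?thesis by blast
    qed
    then have "inj_on ?h (S \<union> (I - S))"
      by (rule inj_on_disjoint_Un[OF f(1) g(1)])
    moreover have "S \<union> (I - S) = I" using tight(1) by blast
    moreover have "\<forall>i\<in>I. ?h i \<in> N i" using f(2) g(2) by simp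
    ultimately show ?thesis by (intro exI[of _ ?h]) simp
  qed
qed

text \<open>A matching along pairs at distance at most \<open>\<delta>\<close> would bound the
  matching distance by \<open>\<delta>\<close>. So Hall's condition fails for some \<open>S\<close>,
  and \<open>T\<close> is chosen among the indices that are not neighbours of
  \<open>S\<close>.\<close>

lemma matching_dist_list_gt_obtain:
  assumes len: "length xs = n" "length ys = n" and n: "n > 0"
    and gt: "\<delta> < matching_dist_list xs ys"
  obtains S T where "S \<subseteq> {..<n}" "T \<subseteq> {..<n}" "card S + card T = n + 1"
    "\<And>i j. i \<in> S \<Longrightarrow> j \<in> T \<Longrightarrow> \<delta> < cmod (xs ! i - ys ! j)"
proof -
  define N where "N i = {j\<in>{..<n}. cmod (xs ! i - ys ! j) \<le> \<delta>}" for i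
  have N_fin: "finite (N i)" for i by (simp add: N_def)
  have "\<not> (\<exists>f. inj_on f {..<n} \<and> (\<forall>i\<in>{..<n}. f i \<in> N i))"
  proof
    assume "\<exists>f. inj_on f {..<n} \<and> (\<forall>i\<in>{..<n}. f i \<in> N i)"
    then obtain f where f: "inj_on f {..<n}" "\<forall>i\<in>{..<n}. f i \<in> N i" by blast
    \<comment> \<open>\<open>permutes\<close> demands the identity outside the index set.\<close>
    define \<tau> where "\<tau> i = (if i < n then f i else i)" for i
    have "f ` {..<n} = {..<n}"
      using f by (intro endo_inj_surj) (auto simp: N_def)
    then have "bij_betw \<tau> {..<n} {..<n}"
      using f(1) by (auto simp: bij_betw_def inj_on_def \<tau>_def)
    then have "\<tau> permutes {..<n}"
      by (rule bij_imp_permutes) (simp add: \<tau>_def)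
    then have "matching_dist_list xs ys \<le> Max ((\<lambda>i. cmod (xs ! i - ys ! \<tau> i)) ` {..<n})"
      unfolding matching_dist_list_def len(1)
      by (intro Min_le finite_imageI finite_permutations imageI) auto
    also have "\<dots> \<le> \<delta>"
      using f(2) n by (subst Max_le_iff) (auto simp: N_def \<tau>_def)
    finally show False using gt by simp
  qed
  then obtain S where S: "S \<subseteq> {..<n}" "card (\<Union>(N ` S)) < card S"
    using hall_marriage[of "{..<n}" N] N_fin by (meson finite_lessThan not_le)
  have U: "\<Union>(N ` S) \<subseteq> {..<n}" by (auto simp: N_def)
  \<comment> \<open>The strict failure of Hall's condition yields the extra 1. Cutting
    \<open>T\<close> down to exactly this size later forces the smaller of the two sets to have at
    most \<open>(n + 1) div 2\<close> elements.\<close>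
  have "n + 1 - card S \<le> card ({..<n} - \<Union>(N ` S))"
    using S U by (subst card_Diff_subset) (auto intro: finite_subset)
  then obtain T where T: "T \<subseteq> {..<n} - \<Union>(N ` S)" "card T = n + 1 - card S"
    by (meson obtain_subset_with_card_n)
  have "card S \<le> n" using card_mono[OF _ S(1)] by simp
  show ?thesis
  proof (rule that)
    show "card S + card T = n + 1" using T(2) \<open>card S \<le> n\<close> by simp
    show "\<delta> < cmod (xs ! i - ys ! j)" if "i \<in> S" "j \<in> T" for i j
      using that T(1) by (force simp: N_def)
  qed (use S T in auto)
qed

section \<open>The matching distance bound\<close>

lemma diagonal_mat_mult_index:
  fixes D :: "'a :: comm_semiring_0 mat"
  assumes "D \<in> carrier_mat n n" "diagonal_mat D" "W \<in> carrier_mat n n" "i < n" "j < n"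
  shows "(D * W) $$ (i, j) = D $$ (i, i) * W $$ (i, j)"
    and "(W * D) $$ (i, j) = W $$ (i, j) * D $$ (j, j)"
proof -
  have "(D * W) $$ (i, j) = (\<Sum>k\<in>{0..<n}. D $$ (i, k) * W $$ (k, j))"
    using assms by (simp add: scalar_prod_def)
  also have "\<dots> = D $$ (i, i) * W $$ (i, j)"
    using assms by (subst sum.remove[of _ i]) (auto simp: diagonal_mat_def intro!: sum.neutral)
  finally show "(D * W) $$ (i, j) = D $$ (i, i) * W $$ (i, j)" .
  have "(W * D) $$ (i, j) = (\<Sum>k\<in>{0..<n}. W $$ (i, k) * D $$ (k, j))"
    using assms by (simp add: scalar_prod_def)
  also have "\<dots> = W $$ (i, j) * D $$ (j, j)"
    using assms by (subst sum.remove[of _ j]) (auto simp: diagonal_mat_def intro!: sum.neutral)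
  finally show "(W * D) $$ (i, j) = W $$ (i, j) * D $$ (j, j)" .
qed

lemma isometry_col_norm:
  assumes W: "W \<in> carrier_mat n k" "mat_adjoint W * W = 1\<^sub>m k" and j: "j < k"
  shows "(\<Sum>i<n. (cmod (W $$ (i, j)))\<^sup>2) = 1"
proof -
  have "vec_norm2 (col W j) = 1"
    using isometry_vec_norm2[OF W, of "unit_vec k j"] j
    by (simp add: vec_norm2_unit mult_mat_unit_vec[OF W(1)])
  then have "(vec_norm2 (col W j))\<^sup>2 = 1" by simp
  then show ?thesis using W j by (simp add: vec_norm2_square)
qed

text \<open>The rows and columns of \<open>W\<close> are unit vectors, so deleting the \<open>n - |S|\<close> rows outside \<open>S\<close>
  from the columns in \<open>T\<close> costs at most \<open>n - |S|\<close> of their total mass \<open>|T|\<close>.\<close>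

lemma unitary_block_mass:
  assumes W: "W \<in> carrier_mat n n" "mat_adjoint W * W = 1\<^sub>m n" "W * mat_adjoint W = 1\<^sub>m n"
    and S: "S \<subseteq> {..<n}" and T: "T \<subseteq> {..<n}"
  shows "real (card S + card T) - real n \<le> (\<Sum>j\<in>T. \<Sum>i\<in>S. (cmod (W $$ (i, j)))\<^sup>2)"
proof -
  define w where "w i j = (cmod (W $$ (i, j)))\<^sup>2" for i j
  have W': "mat_adjoint W \<in> carrier_mat n n" using W by auto
  have col: "(\<Sum>i<n. w i j) = 1" if "j < n" for j
    using isometry_col_norm[OF W(1,2) that] by (simp add: w_def)
  have row: "(\<Sum>j<n. w i j) = 1" if "i < n" for i
    using isometry_col_norm[OF W', of i] W that by (simp add: w_def)
  have fin: "finite S" "finite T" using S T by (auto intro: finite_subset)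
  have "real (card T) = (\<Sum>j\<in>T. \<Sum>i<n. w i j)"
    using T col by (subst sum.cong[OF refl, of T _ "\<lambda>_. 1"]) auto
  also have "\<dots> = (\<Sum>j\<in>T. (\<Sum>i\<in>S. w i j) + (\<Sum>i\<in>{..<n} - S. w i j))"
    using S by (intro sum.cong refl) (simp add: sum.subset_diff add.commute)
  also have "\<dots> = (\<Sum>j\<in>T. \<Sum>i\<in>S. w i j) + (\<Sum>i\<in>{..<n} - S. \<Sum>j\<in>T. w i j)"
    unfolding sum.distrib by (subst (2) sum.swap) simp
  also have "(\<Sum>i\<in>{..<n} - S. \<Sum>j\<in>T. w i j) \<le> (\<Sum>i\<in>{..<n} - S. \<Sum>j<n. w i j)"
    using T by (intro sum_mono sum_mono2) (auto simp: w_def)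
  also have "\<dots> = real (card ({..<n} - S))"
    using row by simp
  also have "\<dots> = real n - real (card S)"
    using S fin card_mono[OF _ S] by (simp add: card_Diff_subset of_nat_diff)
  finally show ?thesis by (simp add: w_def)
qed

text \<open>Each column of the block is part of a column of \<open>C\<close>, whose norm is at most
  \<open>K\<close>. Applied to the adjoint with the index sets exchanged, it counts rows
  instead.\<close>

lemma block_frob2_le:
  assumes C: "C \<in> carrier_mat n n" and K: "0 \<le> K"
    and bound: "\<And>x. x \<in> carrier_vec n \<Longrightarrow> vec_norm2 (C *\<^sub>v x) \<le> K * vec_norm2 x"
    and S: "S \<subseteq> {..<n}" and T: "T \<subseteq> {..<n}"
  shows "(\<Sum>j\<in>T. \<Sum>i\<in>S. (cmod (C $$ (i, j)))\<^sup>2) \<le> real (card T) * K\<^sup>2"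
proof -
  have "(\<Sum>i\<in>S. (cmod (C $$ (i, j)))\<^sup>2) \<le> K\<^sup>2" if j: "j \<in> T" for j
  proof -
    have jn: "j < n" using j T by auto
    have "vec_norm2 (col C j) \<le> K"
      by (rule col_vec_norm2_le[OF C bound jn])
    then have "(\<Sum>i<n. (cmod (C $$ (i, j)))\<^sup>2) \<le> K\<^sup>2"
      using C jn power_mono[of "vec_norm2 (col C j)" K 2] by (simp add: vec_norm2_square)
    moreover have "(\<Sum>i\<in>S. (cmod (C $$ (i, j)))\<^sup>2) \<le> (\<Sum>i<n. (cmod (C $$ (i, j)))\<^sup>2)"
      using S by (intro sum_mono2) auto
    ultimately show ?thesis by linarith
  qed
  then have "(\<Sum>j\<in>T. \<Sum>i\<in>S. (cmod (C $$ (i, j)))\<^sup>2) \<le> (\<Sum>j\<in>T. K\<^sup>2)"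
    by (rule sum_mono)
  then show ?thesis by simp
qed

lemma normal_matching_dist_le:
  assumes n: "n > 0" and A: "A \<in> carrier_mat n n" "normal_mat A" and B: "B \<in> carrier_mat n n" "normal_mat B"
  shows "matching_dist (eigenvalue_mset A) (eigenvalue_mset B)
    \<le> sqrt (real (min (vec_space.rank n (A - B)) ((n + 1) div 2))) * spectral_norm (A - B)"
proof (rule ccontr)
  define D where "D = A - B"
  define K where "K = spectral_norm D"
  define p where "p = min (vec_space.rank n D) ((n + 1) div 2)"
  have D: "D \<in> carrier_mat n n" using A B by (auto simp: D_def)
  have K: "0 \<le> K" using spectral_norm_nonneg[OF D] by (simp add: K_def)
  have D_bound: "vec_norm2 (D *\<^sub>v x) \<le> K * vec_norm2 x" if "x \<in> carrier_vec n" for x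
    using vec_norm2_mult_le[OF D that] by (simp add: K_def)
  obtain U where U: "U \<in> carrier_mat n n" "mat_adjoint U * U = 1\<^sub>m n" "diagonal_mat (mat_adjoint U * A * U)"
    using normal_mat_diagonalization[OF A] by blast
  obtain V where V: "V \<in> carrier_mat n n" "mat_adjoint V * V = 1\<^sub>m n" "diagonal_mat (mat_adjoint V * B * V)"
    using normal_mat_diagonalization[OF B] by blast
  have U': "mat_adjoint U \<in> carrier_mat n n" and V': "mat_adjoint V \<in> carrier_mat n n"
    using U V by auto
  have UU': "U * mat_adjoint U = 1\<^sub>m n" and VV': "V * mat_adjoint V = 1\<^sub>m n"
    using mat_mult_left_right_inverse[OF U' U(1,2)] mat_mult_left_right_inverse[OF V' V(1,2)] by auto
  define L where "L = mat_adjoint U * A * U"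
  define M where "M = mat_adjoint V * B * V"
  define W where "W = mat_adjoint U * V"
  define C where "C = mat_adjoint U * (D * V)"
  have L: "L \<in> carrier_mat n n" "diagonal_mat L"
    unfolding L_def by (use A U U' in auto)[1] (fact U(3))
  have M: "M \<in> carrier_mat n n" "diagonal_mat M"
    unfolding M_def by (use B V V' in auto)[1] (fact V(3))
  have W: "W \<in> carrier_mat n n" and C: "C \<in> carrier_mat n n" and DV: "D * V \<in> carrier_mat n n"
    using D U V U' by (auto simp: W_def C_def)
  note assoc = assoc_mult_mat[of _ n n _ n _ n] mult_carrier_mat[of _ n n _ n]
  note unassoc = assoc_mult_mat[of _ n n _ n _ n, symmetric] mult_carrier_mat[of _ n n _ n]
  have cancel: "U * (mat_adjoint U * X) = X" "mat_adjoint U * (U * X) = X"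
    "V * (mat_adjoint V * X) = X" "mat_adjoint V * (V * X) = X"
    if "X \<in> carrier_mat n n" for X
    using U V U' V' UU' VV' that by (simp_all add: unassoc)
  have W': "mat_adjoint W = mat_adjoint V * U"
    unfolding W_def using mat_adjoint_mult[OF U' V(1)] by simp
  have WW: "mat_adjoint W * W = 1\<^sub>m n" "W * mat_adjoint W = 1\<^sub>m n"
    unfolding W' unfolding W_def using U V U' V' by (simp_all add: assoc cancel)
  \<comment> \<open>The inner factors \<open>U U\<^sup>*\<close> and \<open>V V\<^sup>*\<close>
    cancel, so \<open>C\<close> becomes \<open>L * W - W * M\<close>; with \<open>L\<close> and
    \<open>M\<close> diagonal, its entries can be read off.\<close>
  have "L * W = mat_adjoint U * (A * V)" "W * M = mat_adjoint U * (B * V)"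
    unfolding L_def M_def W_def using A B U V U' V' by (simp_all add: assoc cancel)
  moreover have "C = mat_adjoint U * (A * V) - mat_adjoint U * (B * V)"
    unfolding C_def D_def using A B V U'
    by (simp add: minus_mult_distrib_mat[of _ n n _ _ n] mult_minus_distrib_mat[of _ n n _ n])
  ultimately have C_eq: "C = L * W - W * M" by simp
  have C_entry: "C $$ (i, j) = (L $$ (i, i) - M $$ (j, j)) * W $$ (i, j)" if "i < n" "j < n" for i j
    unfolding C_eq using L M W that
    by (simp add: diagonal_mat_mult_index[of L n W] diagonal_mat_mult_index[of M n W] del: index_mult_mat(1))
      (simp add: algebra_simps)
  have C_bound: "vec_norm2 (C *\<^sub>v x) \<le> K * vec_norm2 x" if x: "x \<in> carrier_vec n" for x
  proof -
    have "C *\<^sub>v x = mat_adjoint U *\<^sub>v (D *\<^sub>v (V *\<^sub>v x))"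
      unfolding C_def using D V U' x
      by (simp add: assoc_mult_mat_vec[of _ n n _ n] mult_carrier_mat[of _ n n _ n])
    then have "vec_norm2 (C *\<^sub>v x) = vec_norm2 (D *\<^sub>v (V *\<^sub>v x))"
      using isometry_vec_norm2[OF U', of "D *\<^sub>v (V *\<^sub>v x)"] UU' D V x by simp
    also have "\<dots> \<le> K * vec_norm2 (V *\<^sub>v x)"
      using V x by (intro D_bound) auto
    finally show ?thesis using isometry_vec_norm2[OF V(1,2) x] by simp
  qed
  \<comment> \<open>The rank estimate is made for \<open>D\<close> and carried to \<open>C\<close>
    by unitary invariance; the factor \<open>V\<close> on the right is handled through the
    adjoint.\<close>
  have "frob2 C = frob2 (D * V)"
    unfolding C_def using frob2_isometry[OF U' _ DV] UU' by simp
  also have "\<dots> = frob2 (mat_adjoint V * mat_adjoint D)"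
    using mat_adjoint_mult[OF D V(1)] by (metis frob2_adjoint)
  also have "\<dots> = frob2 D"
    using frob2_isometry[OF V' _ mat_adjoint_carrier[OF D]] VV' by simp
  also have "\<dots> \<le> real (vec_space.rank n D) * K\<^sup>2"
    by (rule frob2_le_rank[OF D K D_bound])
  finally have frob: "frob2 C \<le> real (vec_space.rank n D) * K\<^sup>2" .

  have diag: "eigenvalue_mset A = mset (diag_mat L)" "eigenvalue_mset B = mset (diag_mat M)"
    using eigenvalue_mset_unitary_conj[OF A(1) U] eigenvalue_mset_unitary_conj[OF B(1) V]
    by (simp_all add: L_def M_def)
  have len: "length (diag_mat L) = n" "length (diag_mat M) = n"
    using L M by (simp_all add: diag_mat_def)
  have nth: "diag_mat L ! i = L $$ (i, i)" "diag_mat M ! i = M $$ (i, i)" if "i < n" for i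
    using L M that by (simp_all add: diag_mat_def)
  assume "\<not> ?thesis"
  then have "sqrt (real p) * K < matching_dist_list (diag_mat L) (diag_mat M)"
    using len by (simp add: diag matching_dist_mset p_def K_def D_def)
  \<comment> \<open>A value strictly in between keeps strictness out of the sums over the block:
    non-strict estimates there still contradict \<open>\<delta>(1)\<close>. It also makes
    \<open>\<delta>\<close> positive when \<open>K = 0\<close>.\<close>
  then obtain \<delta> where \<delta>: "sqrt (real p) * K < \<delta>" "\<delta> < matching_dist_list (diag_mat L) (diag_mat M)"
    using dense by blast
  have \<delta>_pos: "0 < \<delta>" using \<delta>(1) K by (smt (verit) mult_nonneg_nonneg real_sqrt_ge_zero of_nat_0_le_iff)
  obtain S T where S: "S \<subseteq> {..<n}" and T: "T \<subseteq> {..<n}" and card: "card S + card T = n + 1"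
    and far': "\<And>i j. i \<in> S \<Longrightarrow> j \<in> T \<Longrightarrow> \<delta> < cmod (diag_mat L ! i - diag_mat M ! j)"
    using matching_dist_list_gt_obtain[OF len n \<delta>(2)] by blast
  have far: "\<delta> < cmod (L $$ (i, i) - M $$ (j, j))" if "i \<in> S" "j \<in> T" for i j
  proof -
    have "i < n" "j < n" using S T that by auto
    with far'[OF that] show ?thesis by (simp add: nth)
  qed
  have fin: "finite S" "finite T" using S T by (auto intro: finite_subset)
  define Q where "Q = (\<Sum>j\<in>T. \<Sum>i\<in>S. (cmod (C $$ (i, j)))\<^sup>2)"
  have "Q \<le> frob2 C"
    unfolding Q_def frob2_altdef using C S T
    by (intro order_trans[OF sum_mono[OF sum_mono2] sum_mono2]) (auto intro: sum_nonneg)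
  then have Q_rank: "Q \<le> real (vec_space.rank n D) * K\<^sup>2" using frob by simp
  have Q_T: "Q \<le> real (card T) * K\<^sup>2"
    unfolding Q_def by (rule block_frob2_le[OF C K C_bound S T])
  \<comment> \<open>The rows of the block are columns of a block of \<open>C\<^sup>*\<close>, which
    obeys the same norm bound.\<close>
  have "(\<Sum>i\<in>S. \<Sum>j\<in>T. (cmod (mat_adjoint C $$ (j, i)))\<^sup>2) \<le> real (card S) * K\<^sup>2"
    by (rule block_frob2_le[OF mat_adjoint_carrier[OF C] K adjoint_vec_norm2_le[OF C K C_bound] T S])
  moreover have "(\<Sum>i\<in>S. \<Sum>j\<in>T. (cmod (mat_adjoint C $$ (j, i)))\<^sup>2) = Q"
    unfolding Q_def using C S T by (subst sum.swap) (auto simp: subset_eq intro!: sum.cong)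
  ultimately have Q_S: "Q \<le> real (card S) * K\<^sup>2" by simp
  \<comment> \<open>If \<open>p\<close> is not the rank, it is \<open>(n + 1) div 2\<close>, and
    \<open>S\<close> and \<open>T\<close> cannot both be larger than that when their sizes add up to
    \<open>n + 1\<close>.\<close>
  have "vec_space.rank n D \<le> p \<or> card S \<le> p \<or> card T \<le> p"
    using card by (auto simp: p_def min_def)
  moreover have "Q \<le> real p * K\<^sup>2" if "Q \<le> real m * K\<^sup>2" "m \<le> p" for m
    using that(1) by (rule order_trans) (use that(2) in \<open>simp add: mult_right_mono\<close>)
  ultimately have Q_le: "Q \<le> real p * K\<^sup>2"
    using Q_rank Q_S Q_T by blast
  have entry: "\<delta>\<^sup>2 * (cmod (W $$ (i, j)))\<^sup>2 \<le> (cmod (C $$ (i, j)))\<^sup>2" if ij: "i \<in> S" "j \<in> T" for i j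
  proof -
    have "\<delta>\<^sup>2 \<le> (cmod (L $$ (i, i) - M $$ (j, j)))\<^sup>2"
      using far[OF ij] \<delta>_pos by (intro power_mono) auto
    moreover have "i < n" "j < n" using ij S T by auto
    ultimately show ?thesis
      by (simp add: C_entry norm_mult power_mult_distrib mult_right_mono)
  qed
  have "1 \<le> (\<Sum>j\<in>T. \<Sum>i\<in>S. (cmod (W $$ (i, j)))\<^sup>2)"
    using unitary_block_mass[OF W WW S T] card by simp
  then have "\<delta>\<^sup>2 \<le> \<delta>\<^sup>2 * (\<Sum>j\<in>T. \<Sum>i\<in>S. (cmod (W $$ (i, j)))\<^sup>2)"
    by (simp add: mult_le_cancel_left1)
  also have "\<dots> \<le> Q"
    unfolding Q_def sum_distrib_left by (intro sum_mono entry)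
  also have "\<dots> \<le> (sqrt (real p) * K)\<^sup>2"
    using Q_le by (simp add: power_mult_distrib)
  also have "\<dots> < \<delta>\<^sup>2"
    using \<delta>(1) K by (intro power_strict_mono) auto
  finally show False by simp
qed

theorem corollary1p2:
  fixes n :: nat and A B :: "complex mat"
  assumes "n \<ge> 1"
    and "A \<in> carrier_mat n n" and "B \<in> carrier_mat n n"
    and "normal_mat A" and "normal_mat B"
  shows "matching_dist (eigenvalue_mset A) (eigenvalue_mset B)
           \<le> sqrt (real (min (vec_space.rank n (A - B)) ((n + 1) div 2))) * spectral_norm (A - B)
       \<and> (vec_space.rank n (A - B) \<le> 1 \<longrightarrow>
           matching_dist (eigenvalue_mset A) (eigenvalue_mset B) \<le> spectral_norm (A - B))"
proof (intro conjI impI)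
  let ?p = "min (vec_space.rank n (A - B)) ((n + 1) div 2)"
  have AB: "A - B \<in> carrier_mat n n" using assms by auto
  show bound: "matching_dist (eigenvalue_mset A) (eigenvalue_mset B)
      \<le> sqrt (real ?p) * spectral_norm (A - B)"
    using normal_matching_dist_le[of n A B] assms by simp
  assume "vec_space.rank n (A - B) \<le> 1"
  \<comment> \<open>The minimum is at most the rank, so the factor under the root is at most
    1.\<close>
  then have "sqrt (real ?p) * spectral_norm (A - B) \<le> 1 * spectral_norm (A - B)"
    by (intro mult_right_mono spectral_norm_nonneg[OF AB]) (simp add: min_def)
  with bound show "matching_dist (eigenvalue_mset A) (eigenvalue_mset B) \<le> spectral_norm (A - B)"
    by simp
qed

end
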